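(* Let $H_i\in C(\mathbb{R}^n,\mathbb{R})$, $i=1,2$, satisfy $H_1(0)=H_2(0)=0$. Let $f,g\in C(\mathbb{R},\mathbb{R})$ be increasing functions having the following properties: (a) for any $\lambda>0$ there exists a unique solution $(u_\lambda,v_\lambda)\in\mathbb{R}^2$ to the system $\lambda u+f(u-v)=0$, $\lambda v+g(v-u)=0$; (b) the family $\{(u_\lambda,v_\lambda)\}_{\lambda>0}$ is bounded in $\mathbb{R}^2$; (c) the family $\{(u_\lambda,v_\lambda)\}_{\lambda>0}$ does not converge as $\lambda\to0+$. Set $B_1(u_1,u_2)=f(u_1-u_2)$ and $B_2(u_1,u_2)=g(u_2-u_1)$ for all $(u_1,u_2)\in\mathbb{R}^2$. For any $\lambda>0$, let $(u_{\lambda,1},u_{\lambda,2})$ be the viscosity solution of the system of Hamilton--Jacobi equations $$\begin{cases}\lambda u_1(x)+H_1(Du_1(x))+B_1(u_1(x),u_2(x))=0 & \text{in } \mathbb{T}^n,\\ \lambda u_2(x)+H_2(Du_2(x))+B_2(u_1(x),u_2(x))=0 & \text{in } \mathbb{T}^n.\end{cases}$$ Then the functions $u_{\lambda,i}$ are constants, the family of the points $(u_{\lambda,1},u_{\lambda,2})$, $\lambda>0$, in $\mathbb{R}^2$ is bounded, and it does not converge as $\lambda\to0+$.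
   Context: $\mathbb{T}^n=\mathbb{R}^n/\mathbb{Z}^n$ is the $n$-dimensional flat torus, and $Du$ denotes the gradient of $u$. "Increasing" means strictly increasing. A pair $(u_1,u_2)\in C(\mathbb{T}^n)^2$ is a viscosity solution of the system if for each $i\in\{1,2\}$ and each $\varphi\in C^1(\mathbb{T}^n)$: whenever $u_i-\varphi$ attains a local maximum at $x$, one has $\lambda u_i(x)+H_i(D\varphi(x))+B_i(u_1(x),u_2(x))\le 0$, and whenever $u_i-\varphi$ attains a local minimum at $x$, one has $\lambda u_i(x)+H_i(D\varphi(x))+B_i(u_1(x),u_2(x))\ge 0$. *)

theory Defs
  imports "HOL-Analysis.Analysis"
begin

text \<open>
  Functions on the flat torus, the quotient of \<^typ>\<open>real^'n\<close> by its integer lattice, are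
  represented by their lattice-periodic lifts to \<^typ>\<open>real^'n\<close>. The projection onto the torus
  is a local homeomorphism, so continuity, gradients and local extrema are those of the lift.
\<close>

definition torus_periodic :: "(real^'n \<Rightarrow> real) \<Rightarrow> bool" where
  "torus_periodic u \<longleftrightarrow> (\<forall>x k. (\<forall>i. k $ i \<in> \<int>) \<longrightarrow> u (x + k) = u x)"

definition C_torus :: "(real^'n \<Rightarrow> real) set" where
  "C_torus = {u. torus_periodic u \<and> continuous_on UNIV u}"

text \<open>\<open>C1_torus \<phi> D\<close>: the function \<open>\<phi>\<close> is continuously differentiable on the torus with gradient \<open>D\<close>.\<close>

definition C1_torus :: "(real^'n \<Rightarrow> real) \<Rightarrow> (real^'n \<Rightarrow> real^'n) \<Rightarrow> bool" where
  "C1_torus \<phi> D \<longleftrightarrow>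
     torus_periodic \<phi> \<and> (\<forall>x. GDERIV \<phi> x :> D x) \<and> continuous_on UNIV D"

definition local_max_at :: "('a::topological_space \<Rightarrow> real) \<Rightarrow> 'a \<Rightarrow> bool" where
  "local_max_at w x \<longleftrightarrow> (\<forall>\<^sub>F y in nhds x. w y \<le> w x)"

definition local_min_at :: "('a::topological_space \<Rightarrow> real) \<Rightarrow> 'a \<Rightarrow> bool" where
  "local_min_at w x \<longleftrightarrow> (\<forall>\<^sub>F y in nhds x. w x \<le> w y)"

text \<open>
  Viscosity inequalities for a single equation \<open>F x (Du x) = 0\<close>; in the system below, the
  zeroth-order terms are absorbed into the dependence of \<open>F\<close> on \<open>x\<close>.
\<close>

definition viscosity_eq ::
  "(real^'n \<Rightarrow> real^'n \<Rightarrow> real) \<Rightarrow> (real^'n \<Rightarrow> real) \<Rightarrow> bool" where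
  "viscosity_eq F u \<longleftrightarrow>
     (\<forall>\<phi> D x. C1_torus \<phi> D \<longrightarrow>
        (local_max_at (\<lambda>y. u y - \<phi> y) x \<longrightarrow> F x (D x) \<le> 0) \<and>
        (local_min_at (\<lambda>y. u y - \<phi> y) x \<longrightarrow> F x (D x) \<ge> 0))"

definition viscosity_solution ::
  "real \<Rightarrow> (real^'n \<Rightarrow> real) \<Rightarrow> (real^'n \<Rightarrow> real) \<Rightarrow>
   (real \<Rightarrow> real \<Rightarrow> real) \<Rightarrow> (real \<Rightarrow> real \<Rightarrow> real) \<Rightarrow>
   (real^'n \<Rightarrow> real) \<times> (real^'n \<Rightarrow> real) \<Rightarrow> bool" where
  "viscosity_solution lam H1 H2 B1 B2 = (\<lambda>(u1, u2).
     u1 \<in> C_torus \<and> u2 \<in> C_torus \<and>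
     viscosity_eq (\<lambda>x p. lam * u1 x + H1 p + B1 (u1 x) (u2 x)) u1 \<and>
     viscosity_eq (\<lambda>x p. lam * u2 x + H2 p + B2 (u1 x) (u2 x)) u2)"

end

theory Submission
  imports Defs
begin

text \<open>
  Since \<open>H1\<close> and \<open>H2\<close> vanish at the zero gradient, the Hamilton--Jacobi system restricted to
  constant functions is the algebraic system for \<open>(U, V)\<close>; what has to be excluded is a
  non-constant solution.

  A continuous function on the torus attains its extrema, and there a constant is an admissible
  test function, with gradient zero. So the maxima \<open>M1, M2\<close> of a viscosity solution satisfy
  \<open>lam * M1 + f (M1 - M2) \<le> 0\<close> and \<open>lam * M2 + g (M2 - M1) \<le> 0\<close>: replacing the value of the
  other component by its maximum does not increase the coupling term, because \<open>f\<close> and \<open>g\<close> are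
  monotone. Thus the maxima form a subsolution of the algebraic system, and likewise the minima
  a supersolution. The algebraic system obeys a comparison principle
  (\<open>monotone_coupling_comparison\<close>), which gives \<open>M1 \<le> U\<close>, \<open>M2 \<le> V\<close> and the reverse inequalities
  for the minima; hence the solution is the constant pair \<open>(U, V)\<close>
  (\<open>viscosity_solution_imp_constant\<close>).

  Conversely a test function touching a constant has a critical point at the contact point, so
  \<open>(U, V)\<close> is a viscosity solution (\<open>viscosity_eq_const\<close>). Boundedness and non-convergence are
  then those of \<open>(U, V)\<close>.
\<close>

lemma torus_periodic_compl:
  assumes "torus_periodic u"
  shows "torus_periodic (\<lambda>x. - u x)"
  using assms by (simp add: torus_periodic_def)

text \<open>Every point is congruent, modulo the lattice, to a point of the compact unit cube.\<close>

lemma C_torus_attains_max: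
  fixes u :: "real^'n \<Rightarrow> real"
  assumes "u \<in> C_torus"
  shows "\<exists>x. \<forall>y. u y \<le> u x"
proof -
  have per: "torus_periodic u" and cont: "continuous_on UNIV u"
    using assms by (auto simp: C_torus_def)
  let ?Q = "cbox (0::real^'n) (\<chi> i. 1)"
  have "compact ?Q" and "continuous_on ?Q u"
    using continuous_on_subset[OF cont] by (auto intro: compact_cbox)
  moreover have "0 \<in> ?Q" by (simp add: mem_box_cart)
  then have "?Q \<noteq> {}" by blast
  ultimately obtain x where x: "\<forall>y\<in>?Q. u y \<le> u x"
    using continuous_attains_sup by metis
  have "u y \<le> u x" for y
  proof -
    let ?k = "(\<chi> i. - of_int \<lfloor>y $ i\<rfloor>) :: real^'n"
    have "y $ i - of_int \<lfloor>y $ i\<rfloor> \<le> 1" for i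
      by linarith
    then have "y + ?k \<in> ?Q"
      by (simp add: mem_box_cart)
    moreover have "u (y + ?k) = u y"
      using per unfolding torus_periodic_def by simp
    ultimately show ?thesis using bspec[OF x, of "y + ?k"] by simp
  qed
  then show ?thesis by blast
qed

lemma C_torus_attains_min:
  fixes u :: "real^'n \<Rightarrow> real"
  assumes "u \<in> C_torus"
  shows "\<exists>x. \<forall>y. u x \<le> u y"
proof -
  have "(\<lambda>x. - u x) \<in> C_torus"
    using assms by (auto simp: C_torus_def intro: torus_periodic_compl continuous_on_minus)
  then obtain x where "\<forall>y. - u y \<le> - u x"
    using C_torus_attains_max by blast
  then show ?thesis by auto
qed

lemma C1_torus_const: "C1_torus (\<lambda>_. c) (\<lambda>_. 0)"
  by (simp add: C1_torus_def torus_periodic_def GDERIV_const)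

lemma viscosity_eq_at_max:
  assumes "viscosity_eq F u" and "\<And>y. u y \<le> u x"
  shows "F x 0 \<le> 0"
proof -
  have "local_max_at (\<lambda>y. u y - 0) x"
    using assms(2) by (simp add: local_max_at_def)
  then show ?thesis
    using assms(1) C1_torus_const[of 0] unfolding viscosity_eq_def by blast
qed

lemma viscosity_eq_at_min:
  assumes "viscosity_eq F u" and "\<And>y. u x \<le> u y"
  shows "F x 0 \<ge> 0"
proof -
  have "local_min_at (\<lambda>y. u y - 0) x"
    using assms(2) by (simp add: local_min_at_def)
  then show ?thesis
    using assms(1) C1_torus_const[of 0] unfolding viscosity_eq_def by blast
qed

lemma GDERIV_zero_at_local_extremum:
  fixes \<phi> :: "real^'n \<Rightarrow> real"
  assumes "GDERIV \<phi> x :> d" and "local_max_at \<phi> x \<or> local_min_at \<phi> x"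
  shows "d = 0"
proof -
  obtain S where "open S" "x \<in> S" "(\<forall>y\<in>S. \<phi> y \<le> \<phi> x) \<or> (\<forall>y\<in>S. \<phi> x \<le> \<phi> y)"
    using assms(2) unfolding local_max_at_def local_min_at_def eventually_nhds by blast
  then have "(\<lambda>h. h \<bullet> d) = (\<lambda>h. 0)"
    using differential_zero_maxmin[of x S \<phi>] assms(1) unfolding gderiv_def by blast
  then show ?thesis by (metis inner_eq_zero_iff)
qed

text \<open>
  A test function touching a constant from either side has a local extremum, hence gradient zero,
  at the contact point, so only the value of \<open>F\<close> at the zero gradient is ever tested.
\<close>

lemma viscosity_eq_const:
  assumes "\<And>x. F x 0 = 0"
  shows "viscosity_eq F (\<lambda>_. c)"
  unfolding viscosity_eq_def
proof (intro allI impI)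
  fix \<phi> :: "real^'a \<Rightarrow> real" and D x
  assume "C1_torus \<phi> D"
  then have "GDERIV \<phi> x :> D x" by (simp add: C1_torus_def)
  moreover have "local_max_at (\<lambda>y. c - \<phi> y) x \<Longrightarrow> local_min_at \<phi> x"
    and "local_min_at (\<lambda>y. c - \<phi> y) x \<Longrightarrow> local_max_at \<phi> x"
    by (simp_all add: local_max_at_def local_min_at_def)
  ultimately have "D x = 0"
    if "local_max_at (\<lambda>y. c - \<phi> y) x \<or> local_min_at (\<lambda>y. c - \<phi> y) x"
    using that GDERIV_zero_at_local_extremum by blast
  then show "(local_max_at (\<lambda>y. c - \<phi> y) x \<longrightarrow> F x (D x) \<le> 0) \<and>
      (local_min_at (\<lambda>y. c - \<phi> y) x \<longrightarrow> F x (D x) \<ge> 0)"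
    using assms[of x] by auto
qed

text \<open>
  Look at the component in which the subsolution \<open>(a, b)\<close> exceeds the supersolution \<open>(c, d)\<close> by
  the larger amount. There the coupling argument is at least as large for the subsolution, and if
  that excess were positive, the discount term would make the left-hand side strictly larger.
\<close>

lemma monotone_coupling_comparison:
  fixes f g :: "real \<Rightarrow> real"
  assumes "lam > 0" and "mono f" and "mono g"
    and sub: "lam * a + f (a - b) \<le> 0" "lam * b + g (b - a) \<le> 0"
    and super: "lam * c + f (c - d) \<ge> 0" "lam * d + g (d - c) \<ge> 0"
  shows "a \<le> c" and "b \<le> d"
proof -
  have "a \<le> c \<and> b \<le> d"
  proof (cases "a - c \<ge> b - d")
    case True
    then have "f (c - d) \<le> f (a - b)" using \<open>mono f\<close> by (simp add: monoD)
    then have "lam * a \<le> lam * c" using sub(1) super(1) by linarith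
    then have "a \<le> c" using \<open>lam > 0\<close> by simp
    then show ?thesis using True by linarith
  next
    case False
    then have "g (d - c) \<le> g (b - a)" using \<open>mono g\<close> by (simp add: monoD)
    then have "lam * b \<le> lam * d" using sub(2) super(2) by linarith
    then have "b \<le> d" using \<open>lam > 0\<close> by simp
    then show ?thesis using False by linarith
  qed
  then show "a \<le> c" and "b \<le> d" by auto
qed

text \<open>
  The maxima of the two components need not be attained at the same point; monotonicity of the
  coupling nevertheless makes the pair of maxima a subsolution of the algebraic system, and the
  pair of minima a supersolution.
\<close>

lemma viscosity_solution_imp_constant:
  fixes H1 H2 :: "real^'n \<Rightarrow> real" and f g :: "real \<Rightarrow> real"
  assumes "lam > 0" and "mono f" and "mono g"
    and H: "H1 0 = 0" "H2 0 = 0"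
    and alg: "lam * a + f (a - b) = 0" "lam * b + g (b - a) = 0"
    and sol: "viscosity_solution lam H1 H2 (\<lambda>r s. f (r - s)) (\<lambda>r s. g (s - r)) (u1, u2)"
  shows "u1 = (\<lambda>_. a)" and "u2 = (\<lambda>_. b)"
proof -
  have C: "u1 \<in> C_torus" "u2 \<in> C_torus"
    and eq1: "viscosity_eq (\<lambda>x p. lam * u1 x + H1 p + f (u1 x - u2 x)) u1"
    and eq2: "viscosity_eq (\<lambda>x p. lam * u2 x + H2 p + g (u2 x - u1 x)) u2"
    using sol by (auto simp: viscosity_solution_def)
  obtain x1 where x1: "\<And>y. u1 y \<le> u1 x1" using C_torus_attains_max[OF C(1)] by blast
  obtain x2 where x2: "\<And>y. u2 y \<le> u2 x2" using C_torus_attains_max[OF C(2)] by blast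
  obtain y1 where y1: "\<And>y. u1 y1 \<le> u1 y" using C_torus_attains_min[OF C(1)] by blast
  obtain y2 where y2: "\<And>y. u2 y2 \<le> u2 y" using C_torus_attains_min[OF C(2)] by blast
  have "f (u1 x1 - u2 x2) \<le> f (u1 x1 - u2 x1)" "g (u2 x2 - u1 x1) \<le> g (u2 x2 - u1 x2)"
    using x1 x2 by (simp_all add: monoD[OF \<open>mono f\<close>] monoD[OF \<open>mono g\<close>])
  then have "lam * u1 x1 + f (u1 x1 - u2 x2) \<le> 0" "lam * u2 x2 + g (u2 x2 - u1 x1) \<le> 0"
    using viscosity_eq_at_max[OF eq1 x1] viscosity_eq_at_max[OF eq2 x2] H by linarith+
  then have max: "u1 x1 \<le> a" "u2 x2 \<le> b"
    using monotone_coupling_comparison[OF assms(1-3), of "u1 x1" "u2 x2" a b] alg by simp_all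
  have "f (u1 y1 - u2 y1) \<le> f (u1 y1 - u2 y2)" "g (u2 y2 - u1 y2) \<le> g (u2 y2 - u1 y1)"
    using y1 y2 by (simp_all add: monoD[OF \<open>mono f\<close>] monoD[OF \<open>mono g\<close>])
  then have "lam * u1 y1 + f (u1 y1 - u2 y2) \<ge> 0" "lam * u2 y2 + g (u2 y2 - u1 y1) \<ge> 0"
    using viscosity_eq_at_min[OF eq1 y1] viscosity_eq_at_min[OF eq2 y2] H by linarith+
  then have min: "a \<le> u1 y1" "b \<le> u2 y2"
    using monotone_coupling_comparison[OF assms(1-3), of a b "u1 y1" "u2 y2"] alg by simp_all
  show "u1 = (\<lambda>_. a)" and "u2 = (\<lambda>_. b)"
    using order_trans[OF x1 max(1)] order_trans[OF min(1) y1]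
      order_trans[OF x2 max(2)] order_trans[OF min(2) y2]
    by (intro ext antisym; simp)+
qed

lemma viscosity_solution_const:
  fixes H1 H2 :: "real^'n \<Rightarrow> real"
  assumes "H1 0 = 0" and "H2 0 = 0"
    and "lam * a + B1 a b = 0" and "lam * b + B2 a b = 0"
  shows "viscosity_solution lam H1 H2 B1 B2 (\<lambda>_. a, \<lambda>_. b)"
  unfolding viscosity_solution_def
  using assms by (auto simp: C_torus_def torus_periodic_def intro!: viscosity_eq_const)

theorem corollary2:
  fixes H1 H2 :: "real^'n \<Rightarrow> real"
    and f g :: "real \<Rightarrow> real"
    and B1 B2 :: "real \<Rightarrow> real \<Rightarrow> real"
    and U V :: "real \<Rightarrow> real"
  assumes "continuous_on UNIV H1" and "continuous_on UNIV H2"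
    and "H1 0 = 0" and "H2 0 = 0"
    and "continuous_on UNIV f" and "continuous_on UNIV g"
    and "strict_mono f" and "strict_mono g"
    and "\<forall>lam>0. \<exists>!(p::real \<times> real).
           lam * fst p + f (fst p - snd p) = 0 \<and> lam * snd p + g (snd p - fst p) = 0"
    and "\<forall>lam>0. lam * U lam + f (U lam - V lam) = 0 \<and> lam * V lam + g (V lam - U lam) = 0"
    and "bounded ((\<lambda>lam. (U lam, V lam)) ` {0<..})"
    and "\<not> (\<exists>l. ((\<lambda>lam. (U lam, V lam)) \<longlongrightarrow> l) (at_right 0))"
    and "\<And>a b. B1 a b = f (a - b)" and "\<And>a b. B2 a b = g (b - a)"
  shows "(\<forall>lam>0. \<exists>!w. viscosity_solution lam H1 H2 B1 B2 w) \<and>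
    (\<forall>u1 u2. (\<forall>lam>0. viscosity_solution lam H1 H2 B1 B2 (u1 lam, u2 lam)) \<longrightarrow>
      (\<exists>c1 c2 :: real \<Rightarrow> real.
         (\<forall>lam>0. \<forall>x. u1 lam x = c1 lam \<and> u2 lam x = c2 lam) \<and>
         bounded ((\<lambda>lam. (c1 lam, c2 lam)) ` {0<..}) \<and>
         \<not> (\<exists>l. ((\<lambda>lam. (c1 lam, c2 lam)) \<longlongrightarrow> l) (at_right 0))))"
proof -
  have B: "B1 = (\<lambda>r s. f (r - s))" "B2 = (\<lambda>r s. g (s - r))"
    by (simp_all add: fun_eq_iff assms(13,14))
  note alg = assms(10)[rule_format]
  have const: "u1 = (\<lambda>_. U lam)" "u2 = (\<lambda>_. V lam)"
    if "lam > 0" and "viscosity_solution lam H1 H2 B1 B2 (u1, u2)" for lam u1 u2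
    using viscosity_solution_imp_constant[of lam f g H1 H2 "U lam" "V lam" u1 u2]
      strict_mono_mono[OF assms(7)] strict_mono_mono[OF assms(8)] assms(3,4) alg[of lam] that
    unfolding B by simp_all
  have "\<exists>!w. viscosity_solution lam H1 H2 B1 B2 w" if "lam > 0" for lam
  proof (rule ex1I)
    show "viscosity_solution lam H1 H2 B1 B2 (\<lambda>_. U lam, \<lambda>_. V lam)"
      using alg[OF that] assms(3,4) by (intro viscosity_solution_const) (auto simp: B)
    show "w = (\<lambda>_. U lam, \<lambda>_. V lam)" if "viscosity_solution lam H1 H2 B1 B2 w" for w
      using const[OF \<open>lam > 0\<close>] that by (cases w) auto
  qed
  moreover have "\<exists>c1 c2 :: real \<Rightarrow> real.
         (\<forall>lam>0. \<forall>x. u1 lam x = c1 lam \<and> u2 lam x = c2 lam) \<and>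
         bounded ((\<lambda>lam. (c1 lam, c2 lam)) ` {0<..}) \<and>
         \<not> (\<exists>l. ((\<lambda>lam. (c1 lam, c2 lam)) \<longlongrightarrow> l) (at_right 0))"
    if "\<forall>lam>0. viscosity_solution lam H1 H2 B1 B2 (u1 lam, u2 lam)" for u1 u2
  proof (intro exI conjI)
    show "\<forall>lam>0. \<forall>x. u1 lam x = U lam \<and> u2 lam x = V lam"
      using const[OF _ that[rule_format]] by metis
  qed (use assms(11,12) in auto)
  ultimately show ?thesis by blast
qed

end
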